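(* Let $G$ be an $n$-vertex connected graph with minimum degree $\delta$. If $q_1(G)<\frac{2n\delta}{n-1}$, then $G$ has a fractional perfect matching.
   Context: Graphs are simple and undirected. For a graph $G$, $A(G)$ is its adjacency matrix, $D(G)$ the diagonal matrix of vertex degrees, $Q(G)=D(G)+A(G)$ its signless Laplacian, and $q_1(G)$ the largest eigenvalue of $Q(G)$. A fractional matching of $G$ is a function $f:E(G)\to[0,1]$ such that $\sum_{e\in\Gamma(v)}f(e)\le 1$ for each $v\in V(G)$, where $\Gamma(v)$ is the set of edges incident to $v$. A fractional perfect matching of an $n$-vertex graph $G$ is a fractional matching $f$ with $\sum_{e\in E(G)}f(e)=\frac{n}{2}$. *)

theory Defs
  imports "HOL-Analysis.Analysis"
begin

(* A graph is given by its edge set; its vertex set is the whole (finite, nonempty) type 'v. *)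

definition simple_graph :: "'v set set \<Rightarrow> bool" where
  "simple_graph E \<longleftrightarrow> (\<forall>e\<in>E. card e = 2)"

definition adjacent :: "'v set set \<Rightarrow> 'v \<Rightarrow> 'v \<Rightarrow> bool" where
  "adjacent E u v \<longleftrightarrow> {u, v} \<in> E"

definition connected_graph :: "'v set set \<Rightarrow> bool" where
  "connected_graph E \<longleftrightarrow> (\<forall>u v. (adjacent E)\<^sup>*\<^sup>* u v)"

definition incident_edges :: "'v set set \<Rightarrow> 'v \<Rightarrow> 'v set set" where
  "incident_edges E v = {e \<in> E. v \<in> e}"

definition degree :: "'v set set \<Rightarrow> 'v \<Rightarrow> nat" where
  "degree E v = card (incident_edges E v)"

definition min_degree :: "'v::finite set set \<Rightarrow> nat" where
  "min_degree E = Min (range (degree E))"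

definition adjacency_matrix :: "'v::finite set set \<Rightarrow> real^'v^'v" where
  "adjacency_matrix E = (\<chi> u v. if adjacent E u v then 1 else 0)"

definition degree_matrix :: "'v::finite set set \<Rightarrow> real^'v^'v" where
  "degree_matrix E = (\<chi> u v. if u = v then real (degree E u) else 0)"

definition signless_Laplacian :: "'v::finite set set \<Rightarrow> real^'v^'v" where
  "signless_Laplacian E = degree_matrix E + adjacency_matrix E"

definition eigenvalue :: "real^'n^'n \<Rightarrow> real \<Rightarrow> bool" where
  "eigenvalue M c \<longleftrightarrow> (\<exists>x. x \<noteq> 0 \<and> M *v x = c *\<^sub>R x)"

(* The signless Laplacian is real symmetric, so its real eigenvalues form a finite nonempty set
   and are all its eigenvalues. *)
definition q1 :: "'v::finite set set \<Rightarrow> real" where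
  "q1 E = Max {c. eigenvalue (signless_Laplacian E) c}"

(* Only the values of f on E matter. *)
definition fractional_matching :: "'v set set \<Rightarrow> ('v set \<Rightarrow> real) \<Rightarrow> bool" where
  "fractional_matching E f \<longleftrightarrow>
     (\<forall>e\<in>E. 0 \<le> f e \<and> f e \<le> 1) \<and> (\<forall>v. (\<Sum>e\<in>incident_edges E v. f e) \<le> 1)"

definition fractional_perfect_matching :: "'v::finite set set \<Rightarrow> ('v set \<Rightarrow> real) \<Rightarrow> bool" where
  "fractional_perfect_matching E f \<longleftrightarrow>
     fractional_matching E f \<and> (\<Sum>e\<in>E. f e) = real CARD('v) / 2"

end

theory Submission
  imports Defs
begin

text \<open>If every vertex set has at least as many neighbours as elements, Hall's theorem gives a
  permutation moving every vertex along an edge, and half its edge multiplicities form a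
  fractional perfect matching. Otherwise some \<open>J\<close> with neighbourhood \<open>N\<close> has
  \<open>|N| < |J|\<close>; then all neighbours of \<open>S = J - N\<close> lie in \<open>T = N - J\<close>, and \<open>|T| < |S|\<close>.
  Between \<open>S\<close> and \<open>T\<close> there are at least \<open>\<delta> |S|\<close> edges, so the Rayleigh quotient of a vector
  constant on \<open>S\<close> and on \<open>T\<close> gives \<open>q1 \<ge> \<delta> (|S| + |T|) / |T| \<ge> \<delta> (2 + 1 / |T|)\<close>, which is at
  least \<open>2 n \<delta> / (n - 1)\<close> since \<open>2 |T| + 1 \<le> n\<close>.\<close>

section \<open>Hall's marriage theorem\<close>

text \<open>Rado's step: if neither deletion preserved Hall's condition, the two violating families
  would contradict submodularity of \<open>J \<mapsto> card (\<Union>(A ` J))\<close>.\<close>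

lemma Hall_deletion:
  fixes A :: "'i \<Rightarrow> 'b set"
  assumes "finite I" and fin: "\<And>j. j \<in> I \<Longrightarrow> finite (A j)"
    and Hall: "\<And>J. J \<subseteq> I \<Longrightarrow> card J \<le> card (\<Union>(A ` J))"
    and i: "i \<in> I" and xy: "x \<noteq> y"
  shows "\<exists>z\<in>{x, y}. \<forall>J\<subseteq>I. card J \<le> card (\<Union>((A(i := A i - {z})) ` J))"
proof (rule ccontr)
  assume "\<not> ?thesis"
  then have viol: "\<exists>J\<subseteq>I. card (\<Union>((A(i := A i - {z})) ` J)) < card J" if "z \<in> {x, y}" for z
    using that by (meson not_le)
  \<comment> \<open>A violating family must contain \<open>i\<close>, since the other sets are
    unchanged. Taking \<open>i\<close> out lowers its cardinality by one, which turns the strict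
    violation into \<le>.\<close>
  have tight: "\<exists>K\<subseteq>I - {i}. card (\<Union>(A ` K) \<union> (A i - {z})) \<le> card K"
    if z: "z \<in> {x, y}" for z
  proof -
    obtain J where J: "J \<subseteq> I" "card (\<Union>((A(i := A i - {z})) ` J)) < card J"
      using viol[OF z] by (elim exE conjE)
    have iJ: "i \<in> J"
    proof (rule ccontr)
      assume "i \<notin> J"
      then have "(A(i := A i - {z})) ` J = A ` J" by (auto simp: image_iff)
      then show False using J Hall[of J] by simp
    qed
    have "\<Union>((A(i := A i - {z})) ` J) = \<Union>(A ` (J - {i})) \<union> (A i - {z})"
      using iJ by auto
    then have "card (\<Union>(A ` (J - {i})) \<union> (A i - {z})) < card J" using J(2) by argo
    moreover have "card (J - {i}) = card J - 1" using iJ by simp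
    ultimately have "card (\<Union>(A ` (J - {i})) \<union> (A i - {z})) \<le> card (J - {i})"
      by linarith
    then show ?thesis using J(1) by (intro exI[of _ "J - {i}"]) auto
  qed
  obtain K where K: "K \<subseteq> I - {i}" "card (\<Union>(A ` K) \<union> (A i - {x})) \<le> card K"
    using tight[of x] by auto
  obtain L where L: "L \<subseteq> I - {i}" "card (\<Union>(A ` L) \<union> (A i - {y})) \<le> card L"
    using tight[of y] by auto
  let ?P = "\<Union>(A ` K) \<union> (A i - {x})" and ?Q = "\<Union>(A ` L) \<union> (A i - {y})"
  have finK: "finite K" and finL: "finite L"
    using K L \<open>finite I\<close> by (auto intro: finite_subset)
  have finP: "finite ?P" and finQ: "finite ?Q"
    using finK finL K L fin i by auto
  have "card (insert i (K \<union> L)) \<le> card (\<Union>(A ` insert i (K \<union> L)))"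
    using K L i by (intro Hall) auto
  \<comment> \<open>\<open>?P\<close> misses at most \<open>x\<close> of \<open>A i\<close> and
    \<open>?Q\<close> at most \<open>y\<close>; as these differ, the union recovers all of
    \<open>A i\<close>.\<close>
  also have "\<Union>(A ` insert i (K \<union> L)) = ?P \<union> ?Q" using xy by auto
  finally have 1: "card (K \<union> L) + 1 \<le> card (?P \<union> ?Q)"
    using finK finL K L by (subst (asm) card_insert_disjoint) auto
  have "card (K \<inter> L) \<le> card (\<Union>(A ` (K \<inter> L)))"
    using K by (intro Hall) auto
  also have "\<dots> \<le> card (?P \<inter> ?Q)" using finP by (intro card_mono) auto
  finally have 2: "card (K \<inter> L) \<le> card (?P \<inter> ?Q)" .
  show False
    \<comment> \<open>Adding \<open>1\<close> and \<open>2\<close> gives |K| + |L| + 1 \<le> |P| +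
      |Q|, while tightness gives |P| + |Q| \<le> |K| + |L|.\<close>
    using 1 2 K(2) L(2) card_Un_Int[OF finK finL] card_Un_Int[OF finP finQ] by linarith
qed

text \<open>Induction on the total size of the sets: \<open>Hall_deletion\<close> shrinks any set
  with two elements. Once all sets are singletons, Hall's condition on pairs of indices makes them
  distinct.\<close>

theorem Hall_marriage:
  fixes A :: "'i \<Rightarrow> 'b set"
  assumes "finite I" and "\<And>i. i \<in> I \<Longrightarrow> finite (A i)"
    and "\<And>J. J \<subseteq> I \<Longrightarrow> card J \<le> card (\<Union>(A ` J))"
  shows "\<exists>r. inj_on r I \<and> (\<forall>i\<in>I. r i \<in> A i)"
  using assms(2,3)
proof (induction "\<Sum>i\<in>I. card (A i)" arbitrary: A rule: less_induct)
  case less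
  note fin = less.prems(1) and Hall = less.prems(2)
  show ?case
  proof (cases "\<exists>i\<in>I. \<exists>x\<in>A i. \<exists>y\<in>A i. x \<noteq> y")
    case True
    then obtain i x y where i: "i \<in> I" and xy: "x \<in> A i" "y \<in> A i" "x \<noteq> y" by blast
    obtain z where z: "z \<in> {x, y}"
      and Hall': "\<And>J. J \<subseteq> I \<Longrightarrow> card J \<le> card (\<Union>((A(i := A i - {z})) ` J))"
      using Hall_deletion[OF \<open>finite I\<close> fin Hall i xy(3)] by blast
    have "card (A i - {z}) < card (A i)"
      using z xy fin[OF i] by (auto intro!: psubset_card_mono)
    then have "(\<Sum>j\<in>I. card ((A(i := A i - {z})) j)) < (\<Sum>j\<in>I. card (A j))"
      using i \<open>finite I\<close> by (intro sum_strict_mono_ex1) auto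
    then obtain r where "inj_on r I" "\<forall>j\<in>I. r j \<in> (A(i := A i - {z})) j"
      using less.hyps[OF _ _ Hall'] fin by (metis fun_upd_apply finite_Diff)
    then show ?thesis by (metis Diff_iff fun_upd_apply)
  next
    case False
    have ne: "A i \<noteq> {}" if "i \<in> I" for i
      using Hall[of "{i}"] that by auto
    define r where "r i = (SOME x. x \<in> A i)" for i
    have r: "A i = {r i}" if "i \<in> I" for i
    proof -
      have "r i \<in> A i" unfolding r_def using ne[OF that] by (simp add: some_in_eq)
      then show ?thesis using False that by blast
    qed
    have "inj_on r I"
    proof (rule inj_onI, rule ccontr)
      fix i j assume ij: "i \<in> I" "j \<in> I" "r i = r j" "i \<noteq> j"
      then show False using Hall[of "{i, j}"] r[of i] r[of j] by simp
    qed
    then show ?thesis using r by blast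
  qed
qed

section \<open>Rayleigh quotients of real symmetric matrices\<close>

lemma inner_symmetric_matrix:
  fixes M :: "real^'n^'n"
  assumes "transpose M = M"
  shows "(M *v x) \<bullet> y = x \<bullet> (M *v y)"
  using dot_lmul_matrix[of x M y] transpose_matrix_vector[of M x] assms by simp

text \<open>Eigenvectors for distinct eigenvalues are orthogonal, hence independent, hence finitely
  many. Finiteness is what makes the \<open>Max\<close> in \<open>q1\<close> an upper bound.\<close>

lemma finite_eigenvalues_symmetric:
  fixes M :: "real^'n^'n"
  assumes "transpose M = M"
  shows "finite {c. eigenvalue M c}"
proof -
  have "\<forall>c. \<exists>x. eigenvalue M c \<longrightarrow> x \<noteq> 0 \<and> M *v x = c *\<^sub>R x"
    unfolding eigenvalue_def by blast
  then obtain v where v: "\<And>c. eigenvalue M c \<Longrightarrow> v c \<noteq> 0 \<and> M *v v c = c *\<^sub>R v c"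
    by metis
  have orth: "v c \<bullet> v d = 0" if "eigenvalue M c" "eigenvalue M d" "c \<noteq> d" for c d
  proof -
    have "c * (v c \<bullet> v d) = d * (v c \<bullet> v d)"
      using inner_symmetric_matrix[OF assms, of "v c" "v d"] v that by simp
    then show ?thesis using that by simp
  qed
  have inj: "inj_on v {c. eigenvalue M c}"
    using orth v by (intro inj_onI) (metis inner_eq_zero_iff mem_Collect_eq)
  have "pairwise orthogonal (v ` {c. eigenvalue M c})"
    using orth by (auto simp: pairwise_def orthogonal_def)
  moreover have "0 \<notin> v ` {c. eigenvalue M c}" using v by auto
  ultimately have "finite (v ` {c. eigenvalue M c})"
    using pairwise_orthogonal_independent independent_imp_finite by blast
  then show ?thesis using inj finite_imageD by blast
qed

text \<open>\<open>x\<close> minimises the quadratic form, so its first variation vanishes in every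
  direction; in the direction \<open>N *v x\<close> it is twice the squared norm of
  \<open>N *v x\<close>.\<close>

lemma symmetric_psd_kernel:
  fixes N :: "real^'n^'n"
  assumes sym: "transpose N = N" and psd: "\<And>y. 0 \<le> y \<bullet> (N *v y)"
    and zero: "x \<bullet> (N *v x) = 0"
  shows "N *v x = 0"
proof -
  let ?y = "N *v x"
  define a b where "a = ?y \<bullet> ?y" and "b = ?y \<bullet> (N *v ?y)"
  have ge: "0 \<le> 2 * t * a + t\<^sup>2 * b" for t
  proof -
    have "0 \<le> (x + t *\<^sub>R ?y) \<bullet> (N *v (x + t *\<^sub>R ?y))" by (rule psd)
    also have "\<dots> = 2 * t * a + t\<^sup>2 * b"
      using inner_symmetric_matrix[OF sym, of x ?y] zero
      by (simp add: a_def b_def matrix_vector_right_distrib matrix_vector_mult_scaleR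
          inner_add_left inner_add_right power2_eq_square algebra_simps)
    finally show ?thesis .
  qed
  have "b \<ge> 0" "a \<ge> 0" using psd by (auto simp: a_def b_def)
  have "a = 0"
  proof (cases "b = 0")
    case True
    then show ?thesis using ge[of "-1"] \<open>a \<ge> 0\<close> by simp
  next
    \<comment> \<open>The parameter -a/b minimises the quadratic in \<open>ge\<close>, where its
      value is -a^2/b.\<close>
    case False
    have "2 * (- (a / b)) * a + (- (a / b))\<^sup>2 * b = - (a\<^sup>2 / b)"
      using False by (simp add: power2_eq_square field_simps)
    then have "a\<^sup>2 / b \<le> 0" using ge[of "- (a / b)"] by simp
    then show ?thesis using False \<open>b \<ge> 0\<close> by (simp add: divide_le_0_iff)
  qed
  then show ?thesis by (simp add: a_def)
qed

text \<open>By compactness the form attains its maximum \<open>c\<close> on the unit sphere at some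
  \<open>u\<close>. Then \<open>c *\<^sub>R mat 1 - M\<close> is positive semidefinite and its form
  vanishes at \<open>u\<close>, so \<open>u\<close> is an eigenvector for \<open>c\<close>.\<close>

lemma Rayleigh_le_Max_eigenvalue:
  fixes M :: "real^'n^'n"
  assumes sym: "transpose M = M"
  shows "x \<bullet> (M *v x) \<le> Max {c. eigenvalue M c} * (x \<bullet> x)"
proof -
  have "compact (sphere (0::real^'n) 1)" "sphere (0::real^'n) 1 \<noteq> {}"
    by auto
  moreover have "continuous_on (sphere (0::real^'n) 1) (\<lambda>y. y \<bullet> (M *v y))"
    by (intro continuous_intros matrix_vector_mult_linear_continuous_on)
  ultimately obtain u where u: "norm u = 1"
    and max: "\<And>y. norm y = 1 \<Longrightarrow> y \<bullet> (M *v y) \<le> u \<bullet> (M *v u)"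
    using continuous_attains_sup[of "sphere (0::real^'n) 1" "\<lambda>y. y \<bullet> (M *v y)"] by auto
  define c where "c = u \<bullet> (M *v u)"
  have bound: "y \<bullet> (M *v y) \<le> c * (y \<bullet> y)" for y
  proof (cases "y = 0")
    case False
    have "(sgn y) \<bullet> (M *v sgn y) \<le> c"
      using max[of "sgn y"] False by (simp add: norm_sgn c_def)
    then have "(y \<bullet> (M *v y)) / (norm y * norm y) \<le> c"
      by (simp add: sgn_div_norm matrix_vector_mult_scaleR divide_simps)
    then show ?thesis
      using False by (simp add: divide_simps power2_norm_eq_inner[symmetric] power2_eq_square)
  qed simp
  let ?N = "c *\<^sub>R mat 1 - M"
  have N: "?N *v y = c *\<^sub>R y - M *v y" for y
    by (simp add: matrix_vector_mult_diff_rdistrib scaleR_matrix_vector_assoc[symmetric])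
  have "transpose ?N = ?N"
    using sym by (simp add: transpose_def mat_def vec_eq_iff)
  moreover have "0 \<le> y \<bullet> (?N *v y)" for y
    using bound[of y] by (simp add: N inner_diff_right)
  moreover have "u \<bullet> (?N *v u) = 0"
    unfolding N inner_diff_right inner_scaleR_right c_def[symmetric]
    using u by (simp add: power2_norm_eq_inner[symmetric])
  ultimately have "?N *v u = 0" by (rule symmetric_psd_kernel)
  then have "eigenvalue M c"
    using u unfolding N eigenvalue_def by (intro exI[of _ u]) auto
  then have "c \<le> Max {c. eigenvalue M c}"
    using finite_eigenvalues_symmetric[OF sym] by (intro Max_ge) auto
  then show ?thesis
    using bound[of x] by (meson inner_ge_zero mult_right_mono order_trans)
qed

section \<open>Sums over incident edges\<close>

lemma adjacent_commute: "adjacent E u v \<longleftrightarrow> adjacent E v u"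
  by (simp add: adjacent_def insert_commute)

lemma not_adjacent_self:
  assumes "simple_graph E"
  shows "\<not> adjacent E v v"
proof
  assume "adjacent E v v"
  then have "card {v, v} = 2"
    using assms unfolding simple_graph_def adjacent_def by blast
  then show False by simp
qed

lemma incident_edges_eq_image:
  assumes "simple_graph E"
  shows "incident_edges E v = (\<lambda>u. {v, u}) ` {u. adjacent E v u}"
proof (intro equalityI subsetI)
  fix e assume "e \<in> incident_edges E v"
  then have e: "e \<in> E" "v \<in> e" "card e = 2"
    using assms by (auto simp: incident_edges_def simple_graph_def)
  then obtain u where "e = {v, u}" by (auto simp: card_2_iff)
  then show "e \<in> (\<lambda>u. {v, u}) ` {u. adjacent E v u}"
    using e by (auto simp: adjacent_def)
qed (auto simp: incident_edges_def adjacent_def)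

lemma sum_incident_edges:
  assumes "simple_graph E"
  shows "(\<Sum>e\<in>incident_edges E v. f e) = (\<Sum>u | adjacent E v u. f {v, u})"
  unfolding incident_edges_eq_image[OF assms]
  by (subst sum.reindex) (auto simp: inj_on_def doubleton_eq_iff)

lemma degree_eq_sum:
  fixes E :: "'v::finite set set"
  assumes "simple_graph E"
  shows "real (degree E v) = (\<Sum>u\<in>UNIV. of_bool (adjacent E v u))"
  using sum_incident_edges[of E "\<lambda>_. 1::real" v, OF assms] by (simp add: degree_def)

lemma handshake:
  fixes E :: "'v::finite set set" and f :: "'v set \<Rightarrow> real"
  assumes "simple_graph E"
  shows "(\<Sum>v\<in>UNIV. \<Sum>e\<in>incident_edges E v. f e) = 2 * (\<Sum>e\<in>E. f e)"
proof -
  have "(\<Sum>v\<in>UNIV. \<Sum>e\<in>incident_edges E v. f e) = (\<Sum>e\<in>E. \<Sum>v | v \<in> e. f e)"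
    unfolding incident_edges_def
    using sum.swap_restrict[of UNIV E "\<lambda>v e. f e" "\<lambda>v e. v \<in> e"] by simp
  also have "\<dots> = (\<Sum>e\<in>E. 2 * f e)"
    using assms by (intro sum.cong) (auto simp: simple_graph_def)
  finally show ?thesis by (simp add: sum_distrib_left)
qed

section \<open>Fractional perfect matchings from Hall's theorem\<close>

text \<open>Each \<open>v\<close> gives weight 1/2 to the edge from \<open>v\<close> to
  \<open>r v\<close>. A 2-cycle of \<open>r\<close> thus yields an edge of weight 1, a longer cycle
  edges of weight 1/2.\<close>

lemma fractional_perfect_matching_of_permutation:
  fixes E :: "'v::finite set set" and r :: "'v \<Rightarrow> 'v"
  assumes sg: "simple_graph E" and inj: "inj r" and adj: "\<And>v. adjacent E v (r v)"
  shows "\<exists>f. fractional_perfect_matching E f"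
proof -
  define f :: "'v set \<Rightarrow> real" where "f e = real (card {v. e = {v, r v}}) / 2" for e
  have bij: "bij r" using inj by (simp add: finite_UNIV_inj_surj bij_betw_def)
  have f: "f {v, u} = (of_bool (r v = u) + of_bool (r u = v)) / 2" if "u \<noteq> v" for u v
  proof -
    have "{w. {v, u} = {w, r w}} = {w \<in> {v}. r v = u} \<union> {w \<in> {u}. r u = v}"
      by (auto simp: doubleton_eq_iff)
    moreover have "card \<dots> = card {w \<in> {v}. r v = u} + card {w \<in> {u}. r u = v}"
      using that by (intro card_Un_disjoint) auto
    ultimately show ?thesis by (simp add: f_def)
  qed
  have one: "(\<Sum>e\<in>incident_edges E v. f e) = 1" for v
  proof -
    have "(\<Sum>e\<in>incident_edges E v. f e)
        = (\<Sum>u | adjacent E v u. (of_bool (r v = u) + of_bool (r u = v)) / 2)"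
      unfolding sum_incident_edges[OF sg]
      using not_adjacent_self[OF sg] by (intro sum.cong refl f) auto
    also have "\<dots> = (\<Sum>u\<in>UNIV. (of_bool (r v = u) + of_bool (r u = v)) / 2)"
      using adj adjacent_commute[of E] by (intro sum.mono_neutral_left) auto
    also have "\<dots> = ((\<Sum>u\<in>UNIV. of_bool (r v = u)) + (\<Sum>u\<in>UNIV. of_bool (r u = v))) / 2"
      by (simp only: sum.distrib sum_divide_distrib[symmetric])
    \<comment> \<open>\<open>v\<close> has exactly one image and one preimage under
      \<open>r\<close>, each contributing 1/2.\<close>
    also have "(\<Sum>u\<in>UNIV. of_bool (r u = v)) = (\<Sum>u\<in>UNIV. of_bool (u = v) :: real)"
      by (rule sum.reindex_bij_betw[OF bij])
    finally show ?thesis by (simp add: of_bool_def sum.delta')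
  qed
  have "fractional_matching E f"
    unfolding fractional_matching_def
  proof (intro conjI ballI allI)
    fix e assume "e \<in> E"
    then obtain u v where "e = {v, u}" "u \<noteq> v"
      using sg by (fastforce simp: simple_graph_def card_2_iff)
    then show "f e \<le> 1" "0 \<le> f e" by (simp_all add: f)
  qed (simp add: one)
  moreover have "(\<Sum>e\<in>E. f e) = real CARD('v) / 2"
    using handshake[OF sg, of f] by (simp add: one)
  ultimately show ?thesis unfolding fractional_perfect_matching_def by blast
qed

lemma fractional_Tutte:
  fixes E :: "'v::finite set set"
  assumes sg: "simple_graph E" and no: "\<nexists>f. fractional_perfect_matching E f"
  shows "\<exists>S T. S \<inter> T = {} \<and> card T < card S \<and> (\<forall>v\<in>S. \<forall>u. adjacent E v u \<longrightarrow> u \<in> T)"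
proof -
  have "\<exists>J. card (\<Union>v\<in>J. {u. adjacent E v u}) < card J"
  proof (rule ccontr)
    assume "\<not> ?thesis"
    then obtain r where "inj r" "\<forall>v. r v \<in> {u. adjacent E v u}"
      using Hall_marriage[of UNIV "\<lambda>v. {u. adjacent E v u}"] by (force simp: not_less)
    then show False using fractional_perfect_matching_of_permutation[OF sg] no by blast
  qed
  then obtain J where J: "card (\<Union>v\<in>J. {u. adjacent E v u}) < card J" by blast
  define N where "N = (\<Union>v\<in>J. {u. adjacent E v u})"
  \<comment> \<open>Removing the common part of \<open>J\<close> and \<open>N\<close> keeps the
    strict inequality. A vertex of \<open>J\<close> outside \<open>N\<close> has no neighbour in
    \<open>J\<close>, so its neighbours all lie in \<open>N - J\<close>.\<close>
  have "card (N - J) < card (J - N)"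
    using J card_Diff_subset_Int[of N J] card_Diff_subset_Int[of J N]
      card_mono[of N "N \<inter> J"] by (simp add: N_def[symmetric] Int_commute)
  moreover have "\<forall>v\<in>J - N. \<forall>u. adjacent E v u \<longrightarrow> u \<in> N - J"
    using adjacent_commute[of E] unfolding N_def by blast
  moreover have "(J - N) \<inter> (N - J) = {}" by blast
  ultimately show ?thesis by blast
qed

section \<open>The quadratic form of Q(G) and the lower bound on its largest eigenvalue\<close>

lemma transpose_signless_Laplacian: "transpose (signless_Laplacian E) = signless_Laplacian E"
  by (simp add: transpose_def signless_Laplacian_def degree_matrix_def adjacency_matrix_def
      vec_eq_iff adjacent_def insert_commute)

text \<open>The sum runs over ordered pairs so that it can be split by rows; the two orientations of
  an edge uv add up to the usual (x_u + x_v)^2.\<close>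

lemma inner_signless_Laplacian:
  fixes E :: "'v::finite set set"
  assumes "simple_graph E"
  shows "x \<bullet> (signless_Laplacian E *v x)
    = (\<Sum>v\<in>UNIV. \<Sum>u\<in>UNIV. of_bool (adjacent E v u) * (x $ v * (x $ v + x $ u)))"
proof -
  have "(signless_Laplacian E *v x) $ v
      = (\<Sum>u\<in>UNIV. of_bool (adjacent E v u) * (x $ v + x $ u))" for v
  proof -
    have "(signless_Laplacian E *v x) $ v
        = (\<Sum>u\<in>UNIV. (if v = u then real (degree E v) * x $ u else 0)
            + of_bool (adjacent E v u) * x $ u)"
      unfolding signless_Laplacian_def degree_matrix_def adjacency_matrix_def
        matrix_vector_mult_def
      by (auto intro!: sum.cong simp: distrib_right)
    also have "\<dots> = real (degree E v) * x $ v + (\<Sum>u\<in>UNIV. of_bool (adjacent E v u) * x $ u)"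
      by (simp add: sum.distrib)
    also have "\<dots> = (\<Sum>u\<in>UNIV. of_bool (adjacent E v u) * (x $ v + x $ u))"
      unfolding degree_eq_sum[OF assms] by (simp add: sum_distrib_right sum.distrib distrib_left)
    finally show ?thesis .
  qed
  then show ?thesis
    by (simp add: inner_vec_def sum_distrib_left algebra_simps)
qed

lemma min_degree_le: "min_degree E \<le> degree E v"
  by (simp add: min_degree_def)

text \<open>The test vector with value \<open>card T\<close> on \<open>S\<close> and \<open>card S\<close> on \<open>T\<close> maximises the Rayleigh
  quotient, over vectors constant on \<open>S\<close> and on \<open>T\<close>, of the bipartite graph between them.\<close>

lemma q1_ge_of_independent_set:
  fixes E :: "'v::finite set set"
  assumes sg: "simple_graph E" and disj: "S \<inter> T = {}" and "S \<noteq> {}" "T \<noteq> {}"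
    and nbr: "\<And>v u. v \<in> S \<Longrightarrow> adjacent E v u \<Longrightarrow> u \<in> T"
  shows "real (min_degree E) * (real (card S) + real (card T)) \<le> q1 E * real (card T)"
proof -
  define s t :: real where "s = real (card S)" and "t = real (card T)"
  have pos: "s > 0" "t > 0" using assms by (simp_all add: s_def t_def card_gt_0_iff)
  define x :: "real^'v" where "x = (\<chi> v. if v \<in> S then t else if v \<in> T then s else 0)"
  have xS: "x $ v = t" if "v \<in> S" for v using that by (simp add: x_def)
  have xT: "x $ v = s" if "v \<in> T" for v using that disj by (auto simp: x_def)
  have x0: "x $ v = 0" if "v \<notin> S" "v \<notin> T" for v using that by (simp add: x_def)
  have xge: "x $ v \<ge> 0" for v using pos by (simp add: x_def)
  define a :: "'v \<Rightarrow> 'v \<Rightarrow> real" where "a v u = of_bool (adjacent E v u)" for v u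
  have a_sym: "a v u = a u v" and a_ge: "a v u \<ge> 0" for v u
    using adjacent_commute[of E] by (simp_all add: a_def)
  define e where "e = (\<Sum>v\<in>S. \<Sum>u\<in>T. a v u)"
  have split: "(\<Sum>v\<in>UNIV. g v) = (\<Sum>v\<in>S. g v) + (\<Sum>v\<in>T. g v)"
    if "\<And>v. v \<notin> S \<Longrightarrow> v \<notin> T \<Longrightarrow> g v = 0" for g :: "'v \<Rightarrow> real"
  proof -
    have "(\<Sum>v\<in>UNIV. g v) = (\<Sum>v\<in>S \<union> T. g v)"
      using that by (intro sum.mono_neutral_right) auto
    then show ?thesis using disj by (simp add: sum.union_disjoint)
  qed
  have "s * real (min_degree E) = (\<Sum>v\<in>S. real (min_degree E))" by (simp add: s_def)
  also have "\<dots> \<le> (\<Sum>v\<in>S. real (degree E v))"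
    by (intro sum_mono) (simp add: min_degree_le)
  also have "\<dots> = e"
    unfolding e_def degree_eq_sum[OF sg] a_def
    using nbr by (intro sum.cong refl sum.mono_neutral_right) auto
  finally have e: "s * real (min_degree E) \<le> e" .
  have xx: "x \<bullet> x = s * t * (s + t)"
    unfolding inner_vec_def by (subst split) (auto simp: x0 xS xT algebra_simps s_def t_def)
  have "(\<Sum>v\<in>S. \<Sum>u\<in>UNIV. a v u * (x $ v * (x $ v + x $ u)))
      = (\<Sum>v\<in>S. \<Sum>u\<in>T. a v u * (x $ v * (x $ v + x $ u)))"
    using nbr by (intro sum.cong refl sum.mono_neutral_right) (auto simp: a_def)
  also have "\<dots> = e * (t * (t + s))"
    by (simp add: xS xT e_def sum_distrib_right)
  finally have Srows: "(\<Sum>v\<in>S. \<Sum>u\<in>UNIV. a v u * (x $ v * (x $ v + x $ u))) = e * (t * (t + s))" .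
  have "e * (s * (s + t)) = (\<Sum>v\<in>T. \<Sum>u\<in>S. a v u * (x $ v * (x $ v + x $ u)))"
    unfolding e_def by (subst sum.swap) (simp add: xS xT sum_distrib_right a_sym)
  also have "\<dots> \<le> (\<Sum>v\<in>T. \<Sum>u\<in>UNIV. a v u * (x $ v * (x $ v + x $ u)))"
    using xge a_ge by (intro sum_mono sum_mono2) auto
  finally have Trows:
    "e * (s * (s + t)) \<le> (\<Sum>v\<in>T. \<Sum>u\<in>UNIV. a v u * (x $ v * (x $ v + x $ u)))" .
  \<comment> \<open>Each of the \<open>e\<close> edges between \<open>S\<close> and \<open>T\<close>
    contributes (s + t)^2. Comparing with \<open>xx\<close> and cancelling s (s + t) leaves the
    claim.\<close>
  have "s * real (min_degree E) * (s + t)\<^sup>2 \<le> e * (s + t)\<^sup>2"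
    using e by (intro mult_right_mono) auto
  also have "\<dots> = e * (t * (t + s)) + e * (s * (s + t))"
    by (simp add: power2_eq_square algebra_simps)
  also have "\<dots> \<le> x \<bullet> (signless_Laplacian E *v x)"
    unfolding inner_signless_Laplacian[OF sg] a_def[symmetric]
    by (subst split) (use Srows Trows in \<open>auto simp: x0\<close>)
  also have "\<dots> \<le> q1 E * (x \<bullet> x)"
    unfolding q1_def by (rule Rayleigh_le_Max_eigenvalue[OF transpose_signless_Laplacian])
  finally have "(s * (s + t)) * (real (min_degree E) * (s + t)) \<le> (s * (s + t)) * (q1 E * t)"
    by (simp add: xx power2_eq_square algebra_simps)
  then show ?thesis
    using pos by (simp add: s_def[symmetric] t_def[symmetric])
qed

text \<open>The all-ones vector has nonnegative Rayleigh quotient. This serves to exclude minimum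
  degree 0 below.\<close>

lemma q1_nonneg:
  fixes E :: "'v::finite set set"
  assumes "simple_graph E"
  shows "0 \<le> q1 E"
proof -
  have "0 \<le> (1 :: real^'v) \<bullet> (signless_Laplacian E *v 1)"
    unfolding inner_signless_Laplacian[OF assms] by (intro sum_nonneg) auto
  also have "\<dots> \<le> q1 E * ((1 :: real^'v) \<bullet> 1)"
    unfolding q1_def by (rule Rayleigh_le_Max_eigenvalue[OF transpose_signless_Laplacian])
  finally show ?thesis
    by (simp add: inner_vec_def zero_le_mult_iff)
qed

theorem theorem4p1:
  fixes E :: "'v::finite set set" and n \<delta> :: nat
  assumes "simple_graph E"
    and "n = CARD('v)"
    and "connected_graph E"
    and "\<delta> = min_degree E"
    and "q1 E < 2 * real n * real \<delta> / (real n - 1)"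
  shows "\<exists>f. fractional_perfect_matching E f"
proof (rule ccontr)
  note sg = \<open>simple_graph E\<close>
  assume "\<nexists>f. fractional_perfect_matching E f"
  then obtain S T where disj: "S \<inter> T = {}" and less: "card T < card S"
    and nbr: "\<And>v u. v \<in> S \<Longrightarrow> adjacent E v u \<Longrightarrow> u \<in> T"
    using fractional_Tutte[OF sg] by blast
  have "S \<noteq> {}" using less by auto
  then obtain v where v: "v \<in> S" by blast
  \<comment> \<open>The strict hypothesis forces a positive minimum degree, so \<open>v\<close> has
    a neighbour; it lies in \<open>T\<close>, which makes division by \<open>t\<close>
    legitimate.\<close>
  have "0 < 2 * real n * real \<delta> / (real n - 1)"
    using q1_nonneg[OF sg] assms(5) by linarith
  then have "\<delta> \<noteq> 0" by (intro notI) simp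
  then have "0 < real (degree E v)" using min_degree_le[of E v] assms(4) by simp
  then have "\<exists>u. adjacent E v u"
    unfolding degree_eq_sum[OF sg] by (metis (full_types) less_irrefl of_bool_eq(1) sum.neutral)
  then have "T \<noteq> {}" using nbr v by blast
  define t where "t = real (card T)"
  have T: "0 < t" using \<open>T \<noteq> {}\<close> by (simp add: t_def card_gt_0_iff)
  have "card S + card T \<le> n"
    using card_mono[of UNIV "S \<union> T"] disj assms(2) by (simp add: card_Un_disjoint)
  with less have n: "2 * t + 1 \<le> real n" by (simp add: t_def)
  \<comment> \<open>The strict inequality between the integers \<open>card T\<close> and
    \<open>card S\<close> supplies the +1 that yields the term 1/t.\<close>
  have "real \<delta> * (2 * real (card T) + 1) \<le> real \<delta> * (real (card S) + real (card T))"
    using less by (intro mult_left_mono) auto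
  also have "\<dots> \<le> q1 E * real (card T)"
    using q1_ge_of_independent_set[OF sg disj \<open>S \<noteq> {}\<close> \<open>T \<noteq> {}\<close> nbr] assms(4) by simp
  finally have "real \<delta> * (2 * t + 1) \<le> q1 E * t"
    by (simp add: t_def)
  then have "real \<delta> * (2 + 1 / t) \<le> q1 E"
    using T by (simp add: field_simps)
  \<comment> \<open>Writing 2n/(n - 1) as 2 + 2/(n - 1) reduces the comparison to 2/(n - 1) \<le>
    1/t, that is, to 2t + 1 \<le> n.\<close>
  moreover have "2 * real n * real \<delta> / (real n - 1) = real \<delta> * (2 + 2 / (real n - 1))"
    using n T by (simp add: field_simps)
  moreover have "2 / (real n - 1) \<le> 1 / t"
    using n T by (simp add: field_simps)
  then have "real \<delta> * (2 + 2 / (real n - 1)) \<le> real \<delta> * (2 + 1 / t)"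
    by (intro mult_left_mono) auto
  ultimately show False using assms(5) by linarith
qed

end
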